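(* Let $d\ge 2$ and $N\ge 1$. Consider the following decision problem (the "piercing problem"). The input consists of real numbers $a^{(j)}_i<b^{(j)}_i$ for $i=0,1,\dots,N$ and $j=1,\dots,d$, satisfying $a^{(j)}_0\le a^{(j)}_i<b^{(j)}_i\le b^{(j)}_0$ for all $i=1,\dots,N$ and all $j$. Let $R_0=\prod_{j=1}^d[a^{(j)}_0,b^{(j)}_0]$. For each $i=1,\dots,N$, define the "cross" $$C_i=\{p\in R_0:\ p_j\in[a^{(j)}_i,b^{(j)}_i]\text{ for some }j\}.$$ Equivalently, $C_i$ is the complement in $R_0$ of the Cartesian product of the complements of $[a^{(j)}_i,b^{(j)}_i]$ in $[a^{(j)}_0,b^{(j)}_0]$. The question is whether $\bigcap_{i=1}^N C_i=\emptyset$. For $d=2$, the cross condition says that a pair of points $x\in[a^{(1)}_0,b^{(1)}_0]$, $y\in[a^{(2)}_0,b^{(2)}_0]$ "pierces" the $i$-th pair of intervals, i.e. $x\in[a^{(1)}_i,b^{(1)}_i]$ or $y\in[a^{(2)}_i,b^{(2)}_i]$. The question then asks whether there is no pair of points piercing all $N$ pairs. An algorithm accesses the input only through queries. A query picks two endpoints belonging to the same coordinate $j$, i.e. two elements of $X_j=\{a^{(j)}_0,\dots,a^{(j)}_N,b^{(j)}_0,\dots,b^{(j)}_N\}$, and receives the answer to which of $x<x'$, $x=x'$, $x>x'$ holds. The algorithm is adaptive: the choice of each query may depend on earlier answers. It must decide correctly, for every admissible input, whether $\bigcap_{i=1}^N C_i=\emptyset$. Then, already for $d=2$ (and hence for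 every $d\ge2$), $O(N)$ queries do not suffice. More precisely, the worst-case number of queries required by any such algorithm is $\Omega(N\log N)$ as $N\to\infty$.
   Context: The worst case is taken over all admissible inputs. $\Omega(N\log N)$ means that there is a constant $c>0$ such that, for all sufficiently large $N$, every correct algorithm uses at least $cN\log N$ queries on some input. *)

theory Defs
  imports Complex_Main "HOL-Library.FuncSet"
begin

text \<open>An input is a pair of families \<open>a\<close>, \<open>b\<close>, where \<open>a j i\<close> and \<open>b j i\<close> are the lower and upper
  endpoint of the \<open>i\<close>-th interval in coordinate \<open>j\<close>. Only the values for \<open>j \<in> {1..d}\<close> and
  \<open>i \<in> {0..N}\<close> are part of the input; the others are never read.\<close>

definition admissible :: "nat \<Rightarrow> nat \<Rightarrow> (nat \<Rightarrow> nat \<Rightarrow> real) \<Rightarrow> (nat \<Rightarrow> nat \<Rightarrow> real) \<Rightarrow> bool" where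
  "admissible d N a b \<longleftrightarrow>
     (\<forall>j\<in>{1..d}. \<forall>i\<in>{0..N}. a j i < b j i) \<and>
     (\<forall>j\<in>{1..d}. \<forall>i\<in>{1..N}. a j 0 \<le> a j i \<and> b j i \<le> b j 0)"

definition outer_box :: "nat \<Rightarrow> (nat \<Rightarrow> nat \<Rightarrow> real) \<Rightarrow> (nat \<Rightarrow> nat \<Rightarrow> real) \<Rightarrow> (nat \<Rightarrow> real) set" where
  "outer_box d a b = (\<Pi>\<^sub>E j\<in>{1..d}. {a j 0..b j 0})"

definition cross ::
  "nat \<Rightarrow> (nat \<Rightarrow> nat \<Rightarrow> real) \<Rightarrow> (nat \<Rightarrow> nat \<Rightarrow> real) \<Rightarrow> nat \<Rightarrow> (nat \<Rightarrow> real) set" where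
  "cross d a b i = {p \<in> outer_box d a b. \<exists>j\<in>{1..d}. p j \<in> {a j i..b j i}}"

text \<open>Algorithms are ternary decision trees: \<open>Query j e e' t\<^sub>1 t\<^sub>2 t\<^sub>3\<close> compares the endpoints \<open>e\<close> and
  \<open>e'\<close> of coordinate \<open>j\<close> and continues with \<open>t\<^sub>1\<close>, \<open>t\<^sub>2\<close> or \<open>t\<^sub>3\<close> when the first is smaller than, equal
  to, or greater than the second. There is no uniformity requirement: the tree may depend
  arbitrarily on \<open>d\<close> and \<open>N\<close>, and computation other than queries is free.\<close>

datatype endpoint = Lower nat | Upper nat

fun endpoint_index :: "endpoint \<Rightarrow> nat" where
  "endpoint_index (Lower i) = i"
| "endpoint_index (Upper i) = i"

fun endpoint_val ::
  "(nat \<Rightarrow> nat \<Rightarrow> real) \<Rightarrow> (nat \<Rightarrow> nat \<Rightarrow> real) \<Rightarrow> nat \<Rightarrow> endpoint \<Rightarrow> real" where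
  "endpoint_val a b j (Lower i) = a j i"
| "endpoint_val a b j (Upper i) = b j i"

datatype algorithm =
    Answer bool
  | Query nat endpoint endpoint algorithm algorithm algorithm

primrec legal :: "nat \<Rightarrow> nat \<Rightarrow> algorithm \<Rightarrow> bool" where
  "legal d N (Answer r) \<longleftrightarrow> True"
| "legal d N (Query j e e' t\<^sub>1 t\<^sub>2 t\<^sub>3) \<longleftrightarrow>
     j \<in> {1..d} \<and> endpoint_index e \<le> N \<and> endpoint_index e' \<le> N \<and> legal d N t\<^sub>1 \<and> legal d N t\<^sub>2 \<and> legal d N t\<^sub>3"

primrec run :: "algorithm \<Rightarrow> (nat \<Rightarrow> nat \<Rightarrow> real) \<Rightarrow> (nat \<Rightarrow> nat \<Rightarrow> real) \<Rightarrow> bool" where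
  "run (Answer r) a b = r"
| "run (Query j e e' t\<^sub>1 t\<^sub>2 t\<^sub>3) a b =
     (if endpoint_val a b j e < endpoint_val a b j e' then run t\<^sub>1 a b
      else if endpoint_val a b j e = endpoint_val a b j e' then run t\<^sub>2 a b
      else run t\<^sub>3 a b)"

primrec num_queries :: "algorithm \<Rightarrow> (nat \<Rightarrow> nat \<Rightarrow> real) \<Rightarrow> (nat \<Rightarrow> nat \<Rightarrow> real) \<Rightarrow> nat" where
  "num_queries (Answer r) a b = 0"
| "num_queries (Query j e e' t\<^sub>1 t\<^sub>2 t\<^sub>3) a b = 1 +
     (if endpoint_val a b j e < endpoint_val a b j e' then num_queries t\<^sub>1 a b
      else if endpoint_val a b j e = endpoint_val a b j e' then num_queries t\<^sub>2 a b
      else num_queries t\<^sub>3 a b)"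

definition solves_piercing :: "nat \<Rightarrow> nat \<Rightarrow> algorithm \<Rightarrow> bool" where
  "solves_piercing d N t \<longleftrightarrow> legal d N t \<and>
     (\<forall>a b. admissible d N a b \<longrightarrow> (run t a b \<longleftrightarrow> (\<Inter>i\<in>{1..N}. cross d a b i) = {}))"

end

theory Submission
  imports Defs "HOL-Combinatorics.Permutations" "HOL-Real_Asymp.Real_Asymp"
begin

text \<open>The complements of the crosses are unions of open orthants, and the question is whether they
  cover the box. Take \<open>n\<close> lower-left quadrants whose corners \<open>(2 * m, 2 * (n + 1 - m))\<close> form a
  descending staircase, labelled by an unknown permutation \<open>\<pi>\<close>, and \<open>n + 1\<close> upper-right quadrants
  that cover the inner corners of this staircase with no slack: moving the left side \<open>2 * k - 1\<close> of the
  \<open>k\<close>-th one up to \<open>2 * k\<close> uncovers a point. Hence a correct algorithm must compare that side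
  with the right side \<open>2 * k\<close> of the quadrant labelled \<open>inv \<pi> k\<close>. If \<open>\<pi>'\<close> produces the same
  answers, then \<open>k \<le> \<pi>' (inv \<pi> k)\<close> for all \<open>k\<close>, which forces \<open>\<pi>' = \<pi>\<close>. So the \<open>n!\<close> permutations
  reach different leaves of a ternary tree.\<close>

subsection \<open>Traces of decision trees\<close>

definition cmp ::
  "(nat \<Rightarrow> nat \<Rightarrow> real) \<Rightarrow> (nat \<Rightarrow> nat \<Rightarrow> real) \<Rightarrow> nat \<Rightarrow> endpoint \<Rightarrow> endpoint \<Rightarrow> real" where
  "cmp a b j e e' = sgn (endpoint_val a b j e - endpoint_val a b j e')"

primrec queried ::
  "algorithm \<Rightarrow> (nat \<Rightarrow> nat \<Rightarrow> real) \<Rightarrow> (nat \<Rightarrow> nat \<Rightarrow> real) \<Rightarrow> (nat \<times> endpoint \<times> endpoint) set" where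
  "queried (Answer r) a b = {}"
| "queried (Query j e e' t1 t2 t3) a b = insert (j, e, e')
     (if endpoint_val a b j e < endpoint_val a b j e' then queried t1 a b
      else if endpoint_val a b j e = endpoint_val a b j e' then queried t2 a b
      else queried t3 a b)"

primrec trace ::
  "algorithm \<Rightarrow> (nat \<Rightarrow> nat \<Rightarrow> real) \<Rightarrow> (nat \<Rightarrow> nat \<Rightarrow> real) \<Rightarrow> real list" where
  "trace (Answer r) a b = []"
| "trace (Query j e e' t1 t2 t3) a b = cmp a b j e e' #
     (if endpoint_val a b j e < endpoint_val a b j e' then trace t1 a b
      else if endpoint_val a b j e = endpoint_val a b j e' then trace t2 a b
      else trace t3 a b)"

lemma length_trace: "length (trace t a b) = num_queries t a b"
  by (induction t) auto

lemma set_trace_subset: "set (trace t a b) \<subseteq> {-1, 0, 1}"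
  by (induction t) (auto simp: cmp_def sgn_if)

lemma cmp_eq_imp_order_eq:
  assumes "cmp a b j e e' = cmp a' b' j e e'"
  shows "endpoint_val a' b' j e < endpoint_val a' b' j e' \<longleftrightarrow> endpoint_val a b j e < endpoint_val a b j e'"
    and "endpoint_val a' b' j e = endpoint_val a' b' j e' \<longleftrightarrow> endpoint_val a b j e = endpoint_val a b j e'"
  using assms by (auto simp: cmp_def sgn_if split: if_splits)

text \<open>Used in contrapositive form: when two inputs get different outputs, some query on the
  path of the first tells them apart.\<close>

lemma run_cong_queried:
  assumes "\<And>j e e'. (j, e, e') \<in> queried t a b \<Longrightarrow> cmp a b j e e' = cmp a' b' j e e'"
  shows "run t a b = run t a' b'"
  using assms
proof (induction t)
  case (Query j e e' t1 t2 t3)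
  note eq = cmp_eq_imp_order_eq[OF Query.prems[of j e e']]
  show ?case
    using Query eq by (simp split: if_splits)
qed simp

text \<open>Recording the answers without the queries is enough: the tree is fixed, so equal answer
  lists lead along the same path.\<close>

lemma trace_eq_imp_cmp_eq:
  assumes "trace t a b = trace t a' b'" "(j, e, e') \<in> queried t a b"
  shows "cmp a b j e e' = cmp a' b' j e e'"
  using assms
proof (induction t)
  case (Query j0 e0 e0' t1 t2 t3)
  have "cmp a b j0 e0 e0' = cmp a' b' j0 e0 e0'"
    using Query.prems(1) by simp
  note eq = this cmp_eq_imp_order_eq[OF this]
  show ?case
    using Query eq by (auto split: if_splits)
qed simp

text \<open>Traces are words of length at most \<open>h\<close> over three letters, and the
  geometric sum counting these words is at most \<open>3 ^ Suc h\<close>.\<close>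

lemma card_le_of_inj_on_trace:
  fixes f g :: "'a \<Rightarrow> nat \<Rightarrow> nat \<Rightarrow> real"
  assumes "inj_on (\<lambda>x. trace t (f x) (g x)) S"
    and "\<And>x. x \<in> S \<Longrightarrow> num_queries t (f x) (g x) \<le> h"
  shows "card S \<le> 3 ^ Suc h"
proof -
  let ?L = "{xs. set xs \<subseteq> {-1, 0, 1 :: real} \<and> length xs \<le> h}"
  have sub: "(\<lambda>x. trace t (f x) (g x)) ` S \<subseteq> ?L"
    using assms(2) set_trace_subset by (simp add: image_subset_iff length_trace)
  have fin: "finite ?L"
    using finite_lists_length_le[of "{-1, 0, 1 :: real}" h] by simp
  have "card S \<le> card ?L"
    by (rule card_inj_on_le[OF assms(1) sub fin])
  also have "\<dots> = (\<Sum>i\<le>h. 3 ^ i)"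
    using card_lists_length_le[of "{-1, 0, 1 :: real}" h] by (simp add: eval_nat_numeral)
  also have "\<dots> \<le> 3 ^ Suc h"
    by (induction h) auto
  finally show ?thesis .
qed

subsection \<open>The adversarial inputs\<close>

text \<open>Indices \<open>1..n\<close> carry the staircase of lower-left quadrants, in the order given by \<open>\<pi>\<close>; index
  \<open>Suc n + k\<close> with \<open>k \<le> n\<close> carries the upper-right quadrant with corner \<open>(r k, 2 * (n - k) - 1)\<close>. All
  further indices are fillers: a filler with axis \<open>j\<close> misses every point whose \<open>j\<close>-th coordinate is
  negative, unless another coordinate lies in its slot \<open>{-2 * m..-2 * m + 1}\<close>.\<close>

definition filler_axis :: "nat \<Rightarrow> nat \<Rightarrow> nat \<Rightarrow> nat" where
  "filler_axis d n i = Suc ((i - (2 * n + 2)) mod d)"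

definition filler_slot :: "nat \<Rightarrow> nat \<Rightarrow> nat \<Rightarrow> nat" where
  "filler_slot d n i = Suc ((i - (2 * n + 2)) div d mod d)"

definition lo :: "nat \<Rightarrow> nat \<Rightarrow> (nat \<Rightarrow> nat) \<Rightarrow> nat \<Rightarrow> nat \<Rightarrow> real" where
  "lo d n \<pi> j i =
    (if i = 0 then - 2 * real d
     else if i \<le> n then
       (if j = 1 then 2 * real (\<pi> i) else if j = 2 then 2 * (real n + 1 - real (\<pi> i)) else -2)
     else if i \<le> 2 * n + 1 then (if j = 1 \<or> j = 2 then - 2 * real d else -2)
     else if j = filler_axis d n i then 0 else - 2 * real (filler_slot d n i))"

definition hi :: "nat \<Rightarrow> nat \<Rightarrow> (nat \<Rightarrow> real) \<Rightarrow> nat \<Rightarrow> nat \<Rightarrow> real" where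
  "hi d n r j i =
    (if i = 0 then 2 * real n + 2
     else if i \<le> n then (if j = 1 \<or> j = 2 then 2 * real n + 2 else -1)
     else if i \<le> 2 * n + 1 then
       (if j = 1 then r (i - Suc n) else if j = 2 then 2 * (real n - real (i - Suc n)) - 1 else -1)
     else if j = filler_axis d n i then 2 * real n + 2 else - 2 * real (filler_slot d n i) + 1)"

text \<open>Odd values, so no \<open>r_base k\<close> ties with an even staircase
  coordinate.\<close>

definition r_base :: "nat \<Rightarrow> real" where
  "r_base k = 2 * real k - 1"

text \<open>Reaching equality suffices: the quadrants are open, so the point
  \<open>(2 * k, 2 * (n - k))\<close> on the raised side is no longer covered.\<close>

definition r_raised :: "nat \<Rightarrow> nat \<Rightarrow> real" where
  "r_raised k = r_base(k := 2 * real k)"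

section \<open>Admissibility of the inputs and the effect of raising one side\<close>

lemma filler_slot_bounds: "d > 0 \<Longrightarrow> 1 \<le> filler_slot d n i \<and> filler_slot d n i \<le> d"
  by (simp add: filler_slot_def Suc_le_eq)

lemma admissible_lo_hi:
  assumes "d \<ge> 2" "\<pi> permutes {1..n}" "\<And>k. k \<le> n \<Longrightarrow> -2 * real d < r k \<and> r k \<le> 2 * real n + 2"
  shows "admissible d N (lo d n \<pi>) (hi d n r)"
proof -
  have \<pi>: "1 \<le> \<pi> i \<and> \<pi> i \<le> n" if "1 \<le> i" "i \<le> n" for i
    using permutes_in_image[OF assms(2), of i] that by auto
  have s: "1 \<le> real (filler_slot d n i) \<and> real (filler_slot d n i) \<le> real d" for i
    using filler_slot_bounds[of d n i] assms(1) by auto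
  have i: "i - Suc n \<le> n" if "i \<le> 2 * n + 1" for i
    using that by linarith
  have *: "lo d n \<pi> j i < hi d n r j i \<and> - 2 * real d \<le> lo d n \<pi> j i \<and> hi d n r j i \<le> 2 * real n + 2" for i j
    using \<pi>[of i] s[of i] assms(1) assms(3)[of "i - Suc n"] i[of i]
    by (auto simp: lo_def hi_def)
  show ?thesis
    unfolding admissible_def using *
    by (simp add: lo_def[of d n \<pi> _ 0] hi_def[of d n r _ 0])
qed

text \<open>Pigeonhole: the \<open>d\<close> slots are pairwise disjoint, and the
  \<open>d - 1\<close> other coordinates can occupy at most \<open>d - 1\<close> of them. This is
  why each axis gets \<open>d\<close> fillers.\<close>

lemma ex_unblocked_slot:
  fixes v :: "nat \<Rightarrow> real"
  assumes "j \<in> {1..d}"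
  shows "\<exists>m\<in>{1..d}. \<forall>j'\<in>{1..d} - {j}. v j' \<notin> {- 2 * real m..- 2 * real m + 1}"
proof (rule ccontr)
  assume "\<not> ?thesis"
  then have "\<forall>m\<in>{1..d}. \<exists>j'. j' \<in> {1..d} - {j} \<and> v j' \<in> {- 2 * real m..- 2 * real m + 1}"
    by blast
  then obtain f where f: "\<And>m. m \<in> {1..d} \<Longrightarrow> f m \<in> {1..d} - {j} \<and> v (f m) \<in> {- 2 * real m..- 2 * real m + 1}"
    by metis
  have "inj_on f {1..d}"
  proof (rule inj_onI)
    fix m m' assume "m \<in> {1..d}" "m' \<in> {1..d}" "f m = f m'"
    then have "v (f m) \<in> {- 2 * real m..- 2 * real m + 1}" "v (f m) \<in> {- 2 * real m'..- 2 * real m' + 1}"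
      using f[of m] f[of m'] by auto
    then show "m = m'"
      by auto
  qed
  then have "card {1..d} \<le> card ({1..d} - {j})"
    using f by (intro card_inj_on_le[of f]) blast+
  then show False
    using assms by (cases d) auto
qed

text \<open>Fillers rule out negative coordinates, which makes the dummy intervals in coordinates
  above 2 irrelevant. The rest is a planar covering by the two families of quadrants.\<close>

lemma Inter_cross_base_empty:
  assumes "d \<ge> 2" "\<pi> permutes {1..n}" "2 * n + 1 + d * d \<le> N"
  shows "(\<Inter>i\<in>{1..N}. cross d (lo d n \<pi>) (hi d n r_base) i) = {}"
proof (rule ccontr)
  assume "\<not> ?thesis"
  then obtain v where "v \<in> (\<Inter>i\<in>{1..N}. cross d (lo d n \<pi>) (hi d n r_base) i)"
    by blast
  then have v: "v \<in> cross d (lo d n \<pi>) (hi d n r_base) i" if "i \<in> {1..N}" for i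
    using that by blast
  have pierced: "\<exists>j\<in>{1..d}. lo d n \<pi> j i \<le> v j \<and> v j \<le> hi d n r_base j i" if "i \<in> {1..N}" for i
    using v[OF that] by (auto simp: cross_def)
  have nonneg: "v j \<ge> 0" if "j \<in> {1..d}" for j
  proof (rule ccontr)
    assume neg: "\<not> v j \<ge> 0"
    obtain m where m: "m \<in> {1..d}"
      "\<And>j'. j' \<in> {1..d} - {j} \<Longrightarrow> v j' \<notin> {- 2 * real m..- 2 * real m + 1}"
      using ex_unblocked_slot[OF \<open>j \<in> {1..d}\<close>] by blast
    \<comment> \<open>The offset has base-\<open>d\<close> digits \<open>m - 1\<close> and
      \<open>j - 1\<close>, from which \<open>filler_slot\<close> and \<open>filler_axis\<close>
      recover \<open>m\<close> and \<open>j\<close>.\<close>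
    define i where "i = 2 * n + 2 + ((m - 1) * d + (j - 1))"
    have "j - 1 < d"
      using that by auto
    then have mod: "((m - 1) * d + (j - 1)) mod d = j - 1" and div: "((m - 1) * d + (j - 1)) div d = m - 1"
      by (simp_all only: mod_mult_self3 mod_less div_mult_self3 div_less)
    have axis: "filler_axis d n i = j" and slot: "filler_slot d n i = m"
      using that m(1) mod div by (auto simp: filler_axis_def filler_slot_def i_def)
    have "(m - 1) * d + d \<le> d * d"
      using m(1) mult_le_mono1[of m d d] by (cases m) auto
    then have "i \<le> N"
      using assms(3) that unfolding i_def by auto
    then obtain j' where "j' \<in> {1..d}" "lo d n \<pi> j' i \<le> v j'" "v j' \<le> hi d n r_base j' i"
      using pierced[of i] by (auto simp: i_def)
    moreover have "i > 2 * n + 1"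
      by (simp add: i_def)
    ultimately show False
      using m(2)[of j'] neg by (cases "j' = j") (auto simp: lo_def hi_def axis slot)
  qed
  have v1: "v 1 \<ge> 0" and v2: "v 2 \<ge> 0"
    using assms(1) by (auto intro!: nonneg)
  \<comment> \<open>The staircase column of \<open>v 1\<close>, capped at the last one. Below height
    \<open>2 * (n - k)\<close> the lower-left quadrant with label \<open>Suc k\<close> covers the
    point; from that height on the \<open>k\<close>-th upper-right quadrant does.\<close>
  define k where "k = min n (nat \<lfloor>v 1 / 2\<rfloor>)"
  have k: "k \<le> n" "2 * real k \<le> v 1"
    using v1 unfolding k_def by (auto simp: min_def) linarith+
  have k_less: "v 1 < 2 * real (Suc k)" if "k < n"
  proof -
    have "k = nat \<lfloor>v 1 / 2\<rfloor>"
      using that by (auto simp: k_def)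
    then have "real k = \<lfloor>v 1 / 2\<rfloor>"
      using v1 by simp
    then have "v 1 / 2 < real k + 1"
      by (metis real_of_int_floor_add_one_gt)
    then show ?thesis
      by simp
  qed
  show False
  proof (cases "v 2 < 2 * (real n - real k)")
    case True
    then have "k < n"
      by (simp add: v2) (use k v2 in linarith)
    then obtain i where i: "i \<in> {1..n}" "\<pi> i = Suc k"
      using permutes_image[OF assms(2)] by (metis Suc_leI atLeastAtMost_iff imageE le_add1 plus_1_eq_Suc)
    then obtain j where "j \<in> {1..d}" "lo d n \<pi> j i \<le> v j" "v j \<le> hi d n r_base j i"
      using pierced[of i] assms(3) by auto
    then show False
      using i True k_less[OF \<open>k < n\<close>] nonneg[of j] by (auto simp: lo_def hi_def split: if_splits)
  next
    case False
    define i where "i = Suc n + k"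
    obtain j where "j \<in> {1..d}" "lo d n \<pi> j i \<le> v j" "v j \<le> hi d n r_base j i"
      using pierced[of i] assms(1,3) k(1) by (auto simp: i_def)
    then show False
      using False k nonneg[of j] by (auto simp: i_def lo_def hi_def r_base_def split: if_splits)
  qed
qed

lemma Inter_cross_raised_nonempty:
  assumes "d \<ge> 2" "\<pi> permutes {1..n}" "k \<in> {1..n}"
  shows "(\<Inter>i\<in>{1..N}. cross d (lo d n \<pi>) (hi d n (r_raised k)) i) \<noteq> {}"
proof -
  \<comment> \<open>The inner corner of the staircase that only the \<open>k\<close>-th upper-right
    quadrant covered. No coordinate is negative, so every filler is pierced along its axis.\<close>
  define v :: "nat \<Rightarrow> real" where
    "v = (\<lambda>j\<in>{1..d}. if j = 1 then 2 * real k else if j = 2 then 2 * (real n - real k) else 0)"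
  have v: "v j = (if j = 1 then 2 * real k else if j = 2 then 2 * (real n - real k) else 0)"
    if "j \<in> {1..d}" for j
    using that by (simp add: v_def)
  have box: "v \<in> outer_box d (lo d n \<pi>) (hi d n (r_raised k))"
    using assms(3) by (auto simp: outer_box_def v_def lo_def hi_def)
  have pierced: "\<exists>j\<in>{1..d}. v j \<in> {lo d n \<pi> j i..hi d n (r_raised k) j i}" if "i \<ge> 1" for i
  proof -
    consider "i \<le> n" "\<pi> i \<le> k" | "i \<le> n" "\<pi> i \<ge> Suc k"
      | "n < i" "i \<le> 2 * n + 1" "i - Suc n < k" | "n < i" "i \<le> 2 * n + 1" "i - Suc n \<ge> k"
      | "i > 2 * n + 1"
      by linarith
    then show ?thesis
    proof cases
      case 1
      then show ?thesis
        using assms(1,3) that by (intro bexI[of _ 1]) (auto simp: v lo_def hi_def)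
    next
      case 2
      then have "real (\<pi> i) \<ge> real k + 1"
        by linarith
      with 2 show ?thesis
        using assms(1,3) that by (intro bexI[of _ 2]) (auto simp: v lo_def hi_def)
    next
      case 3
      then have "real k \<ge> real (i - Suc n) + 1"
        by linarith
      with 3 show ?thesis
        using assms(1,3) that by (intro bexI[of _ 2]) (auto simp: v lo_def hi_def)
    next
      case 4
      then have "real (i - Suc n) \<ge> real k + 1 \<or> i - Suc n = k"
        by linarith
      with 4 show ?thesis
        using assms(1,3) that
        by (intro bexI[of _ 1]) (auto simp: v lo_def hi_def r_raised_def r_base_def)
    next
      case 5
      have "filler_axis d n i \<in> {1..d}"
        using assms(1) by (auto simp: filler_axis_def Suc_le_eq)
      with 5 show ?thesis
        using assms(3) by (intro bexI[of _ "filler_axis d n i"]) (auto simp: v lo_def hi_def)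
    qed
  qed
  have "v \<in> (\<Inter>i\<in>{1..N}. cross d (lo d n \<pi>) (hi d n (r_raised k)) i)"
    using box pierced by (auto simp: cross_def)
  then show ?thesis
    by blast
qed

text \<open>The value \<open>r k\<close> moves from \<open>2 * k - 1\<close> to \<open>2 * k\<close>, and the only other endpoint of coordinate
  1 in that range is the one at \<open>2 * k\<close>.\<close>

lemma cmp_raised_neq:
  assumes "\<pi> permutes {1..n}" "k \<in> {1..n}"
    and "cmp (lo d n \<pi>) (hi d n r_base) j e e' \<noteq> cmp (lo d n \<pi>) (hi d n (r_raised k)) j e e'"
  shows "j = 1 \<and> {e, e'} = {Upper (Suc n + k), Lower (inv \<pi> k)}"
proof -
  let ?U = "Upper (Suc n + k)" and ?L = "Lower (inv \<pi> k)"
  let ?v = "endpoint_val (lo d n \<pi>) (hi d n r_base)"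
    and ?v' = "endpoint_val (lo d n \<pi>) (hi d n (r_raised k))"
  have idx: "i - Suc n = k \<longleftrightarrow> i = Suc n + k" if "n < i" for i
    using that by linarith
  have same: "?v' j e = ?v j e" if "\<not> (j = 1 \<and> e = ?U)" for j e
    using that by (cases e) (auto simp: hi_def r_raised_def idx)
  have U: "?v 1 ?U = 2 * real k - 1" "?v' 1 ?U = 2 * real k"
    using assms(2) by (auto simp: hi_def r_base_def r_raised_def)
  \<comment> \<open>Filler and outer endpoints are at most 0 or equal to \<open>2 * n + 2\<close>,
    hence outside this range as \<open>1 \<le> k \<le> n\<close>; the other values of
    \<open>r_base\<close> are at distance at least 2 from \<open>r_base k\<close>.\<close>
  have L: "e = ?L" if "e \<noteq> ?U" "2 * real k - 1 \<le> ?v 1 e" "?v 1 e \<le> 2 * real k" for e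
  proof (cases e)
    case (Lower i)
    then have "\<pi> i = k"
      using that(2,3) assms(2) by (auto simp: lo_def split: if_splits)
    then show ?thesis
      using Lower permutes_inverses(2)[OF assms(1)] by force
  next
    case (Upper i)
    then show ?thesis
      using that assms(2) by (auto simp: hi_def r_base_def idx filler_slot_def split: if_splits)
  qed
  have "e \<noteq> e'"
    using assms(3) by (auto simp: cmp_def)
  moreover have "j = 1 \<and> (e = ?U \<or> e' = ?U)"
    using assms(3) same[of j e] same[of j e'] unfolding cmp_def by metis
  ultimately have cases: "j = 1 \<and> (e = ?U \<and> e' \<noteq> ?U \<or> e' = ?U \<and> e \<noteq> ?U)"
    by blast
  then have "j = 1"
    by blast
  from cases consider "e = ?U" "e' \<noteq> ?U" | "e' = ?U" "e \<noteq> ?U"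
    by blast
  then show ?thesis
  proof cases
    case 1
    have "2 * real k - 1 \<le> ?v 1 e' \<and> ?v 1 e' \<le> 2 * real k"
      using assms(3) 1 U same[of 1 e'] \<open>j = 1\<close>
      by (auto simp: cmp_def sgn_if simp del: endpoint_val.simps split: if_splits)
    then show ?thesis
      using 1 L \<open>j = 1\<close> by blast
  next
    case 2
    have "2 * real k - 1 \<le> ?v 1 e \<and> ?v 1 e \<le> 2 * real k"
      using assms(3) 2 U same[of 1 e] \<open>j = 1\<close>
      by (auto simp: cmp_def sgn_if simp del: endpoint_val.simps split: if_splits)
    then show ?thesis
      using 2 L \<open>j = 1\<close> by blast
  qed
qed

section \<open>Separating permutations by their traces\<close>

lemma inj_on_trace_permutations:
  assumes "d \<ge> 2" "2 * n + 1 + d * d \<le> N" "solves_piercing d N t"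
  shows "inj_on (\<lambda>\<pi>. trace t (lo d n \<pi>) (hi d n r_base)) {\<pi>. \<pi> permutes {1..n}}"
proof (rule inj_onI, clarify)
  fix \<pi> \<pi>'
  assume \<pi>: "\<pi> permutes {1..n}" and \<pi>': "\<pi>' permutes {1..n}"
    and eq: "trace t (lo d n \<pi>) (hi d n r_base) = trace t (lo d n \<pi>') (hi d n r_base)"
  \<comment> \<open>The forced query has the answer \<open>2 * k - 1 < 2 * k\<close> under
    \<open>\<pi>\<close>. The same answer under \<open>\<pi>'\<close> says
    \<open>2 * k - 1 < 2 * \<pi>' (inv \<pi> k)\<close>, and integrality gives the claim.\<close>
  have "k \<le> (\<pi>' \<circ> inv \<pi>) k" if k: "k \<in> {1..n}" for k
  proof -
    let ?U = "Upper (Suc n + k)" and ?L = "Lower (inv \<pi> k)"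
    have "admissible d N (lo d n \<pi>) (hi d n r_base)"
      "admissible d N (lo d n \<pi>) (hi d n (r_raised k))"
      using assms(1) \<pi> k by (auto intro!: admissible_lo_hi simp: r_base_def r_raised_def)
    then have "run t (lo d n \<pi>) (hi d n r_base) \<noteq> run t (lo d n \<pi>) (hi d n (r_raised k))"
      using assms(3) Inter_cross_base_empty[OF assms(1) \<pi> assms(2)]
        Inter_cross_raised_nonempty[OF assms(1) \<pi> k, of N]
      by (auto simp: solves_piercing_def)
    then obtain j e e' where q: "(j, e, e') \<in> queried t (lo d n \<pi>) (hi d n r_base)"
      "cmp (lo d n \<pi>) (hi d n r_base) j e e' \<noteq> cmp (lo d n \<pi>) (hi d n (r_raised k)) j e e'"
      using run_cong_queried by blast
    have je: "j = 1" "e = ?U \<and> e' = ?L \<or> e = ?L \<and> e' = ?U"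
      using cmp_raised_neq[OF \<pi> k q(2)] by (auto simp: doubleton_eq_iff)
    have "cmp (lo d n \<pi>) (hi d n r_base) j e e' = cmp (lo d n \<pi>') (hi d n r_base) j e e'"
      using trace_eq_imp_cmp_eq[OF eq q(1)] .
    moreover have "inv \<pi> k \<in> {1..n}" "\<pi> (inv \<pi> k) = k"
      using permutes_in_image[OF permutes_inv[OF \<pi>], of k] k permutes_inverses(1)[OF \<pi>] by auto
    ultimately show ?thesis
      using je k by (auto simp: cmp_def sgn_if lo_def hi_def r_base_def split: if_splits)
  qed
  then have "\<pi>' \<circ> inv \<pi> = id"
    using permutes_natset_ge[OF permutes_compose[OF permutes_inv[OF \<pi>] \<pi>']] by blast
  then show "\<pi> = \<pi>'"
    by (metis \<pi> comp_assoc comp_id id_comp permutes_inv_o(2))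
qed

section \<open>Counting permutations and asymptotics\<close>

lemma fact_le_three_power:
  assumes "d \<ge> 2" "2 * n + 1 + d * d \<le> N" "solves_piercing d N t"
    and "\<And>a b. admissible d N a b \<Longrightarrow> num_queries t a b \<le> h"
  shows "fact n \<le> (3 :: nat) ^ Suc h"
proof -
  have "card {\<pi>. \<pi> permutes {1..n}} \<le> 3 ^ Suc h"
  proof (rule card_le_of_inj_on_trace[OF inj_on_trace_permutations[OF assms(1-3)]])
    fix \<pi> assume "\<pi> \<in> {\<pi>. \<pi> permutes {1..n}}"
    then show "num_queries t (lo d n \<pi>) (hi d n r_base) \<le> h"
      using assms(1) by (intro assms(4) admissible_lo_hi) (auto simp: r_base_def)
  qed
  then show ?thesis
    by (simp add: card_permutations)
qed

text \<open>A weak Stirling bound. In the induction, \<open>n * (ln (n + 1) - ln n) \<le> 1\<close>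
  follows from \<open>ln (1 + x) \<le> x\<close>.\<close>

lemma ln_fact_ge: "real n * ln (real n) - real n \<le> ln (fact n)"
proof (induction n)
  case (Suc n)
  show ?case
  proof (cases "n = 0")
    case False
    have "real (Suc n) = real n * (1 + 1 / real n)"
      using False by (simp add: field_simps)
    then have "ln (real (Suc n)) - ln (real n) = ln (1 + 1 / real n)"
      using False by (simp only: ln_mult) (auto simp: ln_mult add_pos_pos)
    also have "\<dots> \<le> 1 / real n"
      using False by (intro ln_add_one_self_le_self) auto
    finally have "real n * (ln (real (Suc n)) - ln (real n)) \<le> 1"
      using False by (simp add: field_simps)
    moreover have "ln (fact (Suc n)) = ln (real (Suc n)) + ln (fact n :: real)"
      by (simp add: ln_mult del: of_nat_Suc)
    moreover have "real (Suc n) * ln (real (Suc n)) = real n * ln (real (Suc n)) + ln (real (Suc n))"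
      by (simp add: algebra_simps)
    ultimately show ?thesis
      using Suc by (simp add: algebra_simps del: fact_Suc)
  qed simp
qed simp

lemma num_queries_lower_bound:
  assumes "d \<ge> 2" "2 * n + 1 + d * d \<le> N" "solves_piercing d N t" "x \<ge> 0"
    and "real n * ln (real n) - real n > 2 * x + 2"
  shows "\<exists>a b. admissible d N a b \<and> real (num_queries t a b) \<ge> x"
proof (rule ccontr)
  assume neg: "\<not> ?thesis"
  have "num_queries t a b \<le> nat \<lfloor>x\<rfloor>" if "admissible d N a b" for a b
  proof -
    have "real (num_queries t a b) < x"
      using neg that by force
    then show ?thesis
      by linarith
  qed
  then have "fact n \<le> (3 :: nat) ^ Suc (nat \<lfloor>x\<rfloor>)"
    using fact_le_three_power[OF assms(1-3)] by blast
  then have "(fact n :: real) \<le> 3 ^ Suc (nat \<lfloor>x\<rfloor>)"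
    by (metis of_nat_fact of_nat_le_iff of_nat_numeral of_nat_power)
  then have "ln (fact n :: real) \<le> ln (3 ^ Suc (nat \<lfloor>x\<rfloor>))"
    by simp
  also have "\<dots> = real (Suc (nat \<lfloor>x\<rfloor>)) * ln 3"
    by (rule ln_realpow)
  \<comment> \<open>The crude estimate \<open>ln 3 \<le> 3 - 1\<close> is the source of
    \<open>2 * x + 2\<close> in the hypothesis.\<close>
  also have "\<dots> \<le> (x + 1) * 2"
    using ln_le_minus_one[of 3] assms(4) by (intro mult_mono) auto
  finally show False
    using ln_fact_ge[of n] assms(5) by simp
qed

theorem theorem2:
  fixes d :: nat
  assumes "d \<ge> 2"
  shows "(\<not> (\<exists>C::real. \<forall>\<^sub>F N in sequentially. \<exists>t. solves_piercing d N t \<and>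
              (\<forall>a b. admissible d N a b \<longrightarrow> real (num_queries t a b) \<le> C * real N)))
    \<and> (\<exists>c::real. c > 0 \<and> (\<forall>\<^sub>F N in sequentially. \<forall>t. solves_piercing d N t \<longrightarrow>
              (\<exists>a b. admissible d N a b \<and> real (num_queries t a b) \<ge> c * real N * ln (real N))))"
proof -
  have bound: "\<forall>\<^sub>F N in sequentially. \<forall>t. solves_piercing d N t \<longrightarrow>
      (\<exists>a b. admissible d N a b \<and> real (num_queries t a b) \<ge> 1 / 10 * real N * ln (real N))"
  proof -
    \<comment> \<open>With \<open>n\<close> about \<open>N / 3\<close> the leading term on the left
      is \<open>N * ln N / 3\<close>, so any constant below \<open>1 / 6\<close> could replace
      \<open>1 / 10\<close>.\<close>
    have "\<forall>\<^sub>F N in sequentially. (real N / 3 - 1) * ln (real N / 3 - 1) - real N / 3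
        > 2 * (1 / 10 * real N * ln (real N)) + 2"
      by real_asymp
    then show ?thesis
      \<comment> \<open>This leaves room for \<open>2 * n + 1 + d * d\<close> indices and makes
        \<open>N / 3 - 1\<close> at least 1, where the logarithm is nonnegative.\<close>
      using eventually_ge_at_top[of "3 * (d * d) + 6"]
    proof eventually_elim
      case (elim N)
      define n where "n = N div 3"
      have n: "real N / 3 - 1 \<le> real n" "real n \<le> real N / 3"
        unfolding n_def by linarith+
      have N: "real N / 3 - 1 \<ge> 1"
        using elim(2) by simp
      have "(real N / 3 - 1) * ln (real N / 3 - 1) \<le> real n * ln (real n)"
        using n N by (intro mult_mono) auto
      then have *: "real n * ln (real n) - real n > 2 * (1 / 10 * real N * ln (real N)) + 2"
        using elim(1) n by linarith
      have "2 * n + 1 + d * d \<le> N"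
        using elim(2) unfolding n_def by linarith
      moreover have "1 / 10 * real N * ln (real N) \<ge> 0"
        using N by (intro mult_nonneg_nonneg) auto
      ultimately show ?case
        using num_queries_lower_bound[OF assms _ _ _ *] by blast
    qed
  qed
  have "\<not> (\<forall>\<^sub>F N in sequentially. \<exists>t. solves_piercing d N t \<and>
      (\<forall>a b. admissible d N a b \<longrightarrow> real (num_queries t a b) \<le> C * real N))" for C :: real
  proof
    assume "\<forall>\<^sub>F N in sequentially. \<exists>t. solves_piercing d N t \<and>
      (\<forall>a b. admissible d N a b \<longrightarrow> real (num_queries t a b) \<le> C * real N)"
    moreover have "\<forall>\<^sub>F N in sequentially. C * real N < 1 / 10 * real N * ln (real N)"
      by real_asymp
    ultimately have "\<forall>\<^sub>F N in sequentially. False"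
      using bound
    proof eventually_elim
      case (elim N)
      then show False
        by (meson not_le order_trans)
    qed
    then show False
      by simp
  qed
  then show ?thesis
    using bound by (intro conjI exI[of _ "1 / 10 :: real"]) auto
qed

end
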